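(* Let $\mathfrak g$ be a real Lie algebra of dimension $2n$ endowed with an integrable complex structure $J$ and an inner product $g$ compatible with $J$ (i.e. $(\mathfrak g,J,g)$ is a Hermitian Lie algebra), and let $D$ be a flat connection on $\mathfrak g$ such that $Dg=0$ and $DJ=0$. Let $T_D\,\mathfrak g=\mathfrak g\ltimes_D\mathbb R^{2n}$ be the tangent Lie algebra determined by $D$, with its induced Hermitian structure $(\tilde J,\tilde g)$. Then $(\tilde J,\tilde g)$ is SKT on $T_D\,\mathfrak g$ if and only if $(J,g)$ is SKT on $\mathfrak g$.
   Context: A complex structure on a real Lie algebra $\mathfrak g$ is a linear map $J:\mathfrak g\to\mathfrak g$ with $J^2=-\mathrm{Id}$ that is integrable, i.e. $J([X,Y]-[JX,JY])-([JX,Y]+[X,JY])=0$ for all $X,Y\in\mathfrak g$. An inner product $g$ is compatible with $J$ if $g(JX,JY)=g(X,Y)$ for all $X,Y$; then $(\mathfrak g,J,g)$ is called a Hermitian Lie algebra, with fundamental $2$-form $\omega(X,Y)=g(JX,Y)$. Let $d$ be the Chevalley--Eilenberg differential on $\Lambda^\bullet\mathfrak g^*$ (so $d\alpha(X,Y)=-\alpha([X,Y])$ for a $1$-form $\alpha$), extended to $\Lambda^\bullet\mathfrak g^*\otimes\mathbb C$, and let $d=\partial+\overline\partial$ be its decomposition according to the $(p,q)$-type defined by $J$. The Hermitian structure $(J,g)$ is SKT (strong Kähler with torsion) if $\partial\overline\partial\omega=0$; equivalently, if $dc=0$, where $c(X,Y,Z)=-d\omega(JX,JY,JZ)$ is the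 torsion $3$-form of the Bismut connection. A connection on $\mathfrak g$ is a bilinear map $D:\mathfrak g\times\mathfrak g\to\mathfrak g$, $(X,Y)\mapsto D_XY$. It is flat if $D_XD_Y-D_YD_X=D_{[X,Y]}$ for all $X,Y$; $Dg=0$ means $g(D_XY,Z)=-g(Y,D_XZ)$ for all $X,Y,Z$; $DJ=0$ means $D_X(JY)=J(D_XY)$ for all $X,Y$. The tangent Lie algebra $T_D\,\mathfrak g=\mathfrak g\ltimes_D\mathbb R^{2n}$ is the vector space $\mathfrak g\oplus\mathfrak g$ (the second summand being the underlying vector space $\mathbb R^{2n}$ of $\mathfrak g$) with the bracket $$[(X_1,X_2),(Y_1,Y_2)]=([X_1,Y_1],\,D_{X_1}Y_2-D_{Y_1}X_2),$$ which satisfies the Jacobi identity because $D$ is flat. Its induced Hermitian structure is $\tilde J(X_1,X_2)=(JX_1,JX_2)$ and $\tilde g((X_1,X_2),(Y_1,Y_2))=g(X_1,Y_1)+g(X_2,Y_2)$; $\tilde J$ is integrable because $J$ is integrable and $DJ=0$. *)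

theory Defs
  imports "HOL-Analysis.Analysis" "HOL-Combinatorics.Permutations"
begin

locale lie_algebra =
  fixes br :: "'a::real_vector \<Rightarrow> 'a \<Rightarrow> 'a"
  assumes bilinear_br: "bilinear br"
    and br_self: "br X X = 0"
    and jacobi: "br X (br Y Z) + br Y (br Z X) + br Z (br X Y) = 0"

locale hermitian_lie_algebra = lie_algebra br
  for br :: "'a::real_vector \<Rightarrow> 'a \<Rightarrow> 'a" +
  fixes J :: "'a \<Rightarrow> 'a" and g :: "'a \<Rightarrow> 'a \<Rightarrow> real"
  assumes linear_J: "linear J"
    and J_J: "J (J X) = - X"
    and integrable_J: "J (br X Y - br (J X) (J Y)) - (br (J X) Y + br X (J Y)) = 0"
    and bilinear_g: "bilinear g"
    and g_sym: "g X Y = g Y X"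
    and g_pos: "X \<noteq> 0 \<Longrightarrow> g X X > 0"
    and g_J: "g (J X) (J Y) = g X Y"

text \<open>
  An element of \<open>\<Lambda>\<^sup>k \<gg>\<^sup>* \<otimes> \<complex>\<close> is a complex-valued, real multilinear
  alternating function of \<open>k\<close> vectors. It is represented by a function on lists of vectors
  that vanishes on all lists whose length is not \<open>k\<close>.
\<close>

type_synonym 'a form = "'a list \<Rightarrow> complex"

definition wedge :: "('a \<Rightarrow> complex) list \<Rightarrow> 'a form" where
  "wedge \<theta>s = (\<lambda>xs. if length xs = length \<theta>s
     then \<Sum>\<sigma> | \<sigma> permutes {..<length \<theta>s}.
            of_int (sign \<sigma>) * (\<Prod>i<length \<theta>s. (\<theta>s ! i) (xs ! \<sigma> i))
     else 0)"

definition covectors10 :: "('a::real_vector \<Rightarrow> 'a) \<Rightarrow> ('a \<Rightarrow> complex) set" where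
  "covectors10 J = {\<theta>. linear \<theta> \<and> (\<forall>X. \<theta> (J X) = \<i> * \<theta> X)}"

definition covectors01 :: "('a::real_vector \<Rightarrow> 'a) \<Rightarrow> ('a \<Rightarrow> complex) set" where
  "covectors01 J = {\<theta>. linear \<theta> \<and> (\<forall>X. \<theta> (J X) = - \<i> * \<theta> X)}"

text \<open>
  \<open>\<Lambda>\<^sup>p\<^sup>,\<^sup>q\<close>: the complex span of the wedge products of \<open>p\<close> covectors of type \<open>(1,0)\<close>
  and \<open>q\<close> covectors of type \<open>(0,1)\<close>.
\<close>

inductive_set forms_pq :: "('a::real_vector \<Rightarrow> 'a) \<Rightarrow> nat \<Rightarrow> nat \<Rightarrow> 'a form set"
  for J p q where
  zero: "(\<lambda>_. 0) \<in> forms_pq J p q"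
| wedge: "\<lbrakk>set \<theta>s \<subseteq> covectors10 J; length \<theta>s = p; set \<eta>s \<subseteq> covectors01 J; length \<eta>s = q\<rbrakk>
    \<Longrightarrow> wedge (\<theta>s @ \<eta>s) \<in> forms_pq J p q"
| add: "\<lbrakk>\<alpha> \<in> forms_pq J p q; \<beta> \<in> forms_pq J p q\<rbrakk> \<Longrightarrow> (\<lambda>xs. \<alpha> xs + \<beta> xs) \<in> forms_pq J p q"
| scale: "\<alpha> \<in> forms_pq J p q \<Longrightarrow> (\<lambda>xs. c * \<alpha> xs) \<in> forms_pq J p q"

text \<open>
  The component of type \<open>(p,q)\<close> of a form of degree \<open>p + q\<close>. It is well defined on
  finite-dimensional spaces, because
  \<open>\<Lambda>\<^sup>k \<gg>\<^sup>* \<otimes> \<complex>\<close> is the direct sum of the spaces \<open>\<Lambda>\<^sup>r\<^sup>,\<^sup>s\<close> with \<open>r + s = k\<close>.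
\<close>

definition type_part :: "('a::real_vector \<Rightarrow> 'a) \<Rightarrow> nat \<Rightarrow> nat \<Rightarrow> 'a form \<Rightarrow> 'a form" where
  "type_part J p q \<alpha> = (THE \<beta>. \<exists>\<gamma>. (\<forall>r\<le>p + q. \<gamma> r \<in> forms_pq J r (p + q - r)) \<and>
     \<alpha> = (\<lambda>xs. \<Sum>r\<le>p + q. \<gamma> r xs) \<and> \<beta> = \<gamma> p)"

text \<open>
  The Chevalley--Eilenberg differential
  \<open>d\<alpha>(X\<^sub>0,\<dots>,X\<^sub>k) = \<Sum>\<^sub>i\<^sub><\<^sub>j (-1)\<^sup>i\<^sup>+\<^sup>j \<alpha>([X\<^sub>i,X\<^sub>j],X\<^sub>0,\<dots>,X\<^sub>k)\<close>, where \<open>X\<^sub>i\<close> and \<open>X\<^sub>j\<close> are omitted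
  from the trailing arguments.
\<close>

definition ce_d :: "('a \<Rightarrow> 'a \<Rightarrow> 'a) \<Rightarrow> 'a form \<Rightarrow> 'a form" where
  "ce_d br \<alpha> = (\<lambda>xs. \<Sum>(i, j) \<in> {(i, j). i < j \<and> j < length xs}.
     (-1) ^ (i + j) * \<alpha> (br (xs ! i) (xs ! j) # nths xs (- {i, j})))"

text \<open>
  In the next two definitions \<open>k\<close> is the degree of the form. On \<open>\<Lambda>\<^sup>p\<^sup>,\<^sup>q\<close> the operators are
  the components of \<open>d\<close> of type \<open>(p+1,q)\<close> and \<open>(p,q+1)\<close>.
\<close>

definition del ::
  "('a::real_vector \<Rightarrow> 'a \<Rightarrow> 'a) \<Rightarrow> ('a \<Rightarrow> 'a) \<Rightarrow> nat \<Rightarrow> 'a form \<Rightarrow> 'a form" where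
  "del br J k \<alpha> = (\<lambda>xs. \<Sum>p\<le>k.
     type_part J (p + 1) (k - p) (ce_d br (type_part J p (k - p) \<alpha>)) xs)"

definition delbar ::
  "('a::real_vector \<Rightarrow> 'a \<Rightarrow> 'a) \<Rightarrow> ('a \<Rightarrow> 'a) \<Rightarrow> nat \<Rightarrow> 'a form \<Rightarrow> 'a form" where
  "delbar br J k \<alpha> = (\<lambda>xs. \<Sum>p\<le>k.
     type_part J p (k - p + 1) (ce_d br (type_part J p (k - p) \<alpha>)) xs)"

definition fundamental_form :: "('a \<Rightarrow> 'a) \<Rightarrow> ('a \<Rightarrow> 'a \<Rightarrow> real) \<Rightarrow> 'a form" where
  "fundamental_form J g =
     (\<lambda>xs. case xs of [X, Y] \<Rightarrow> complex_of_real (g (J X) Y) | _ \<Rightarrow> 0)"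

definition SKT ::
  "('a::real_vector \<Rightarrow> 'a \<Rightarrow> 'a) \<Rightarrow> ('a \<Rightarrow> 'a) \<Rightarrow> ('a \<Rightarrow> 'a \<Rightarrow> real) \<Rightarrow> bool" where
  "SKT br J g \<longleftrightarrow> del br J 3 (delbar br J 2 (fundamental_form J g)) = (\<lambda>_. 0)"

definition flat_connection ::
  "('a::real_vector \<Rightarrow> 'a \<Rightarrow> 'a) \<Rightarrow> ('a \<Rightarrow> 'a \<Rightarrow> 'a) \<Rightarrow> bool" where
  "flat_connection br D \<longleftrightarrow> bilinear D \<and>
     (\<forall>X Y Z. D X (D Y Z) - D Y (D X Z) = D (br X Y) Z)"

definition tangent_br ::
  "('a::real_vector \<Rightarrow> 'a \<Rightarrow> 'a) \<Rightarrow> ('a \<Rightarrow> 'a \<Rightarrow> 'a) \<Rightarrow> 'a \<times> 'a \<Rightarrow> 'a \<times> 'a \<Rightarrow> 'a \<times> 'a" where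
  "tangent_br br D = (\<lambda>(X1, X2) (Y1, Y2). (br X1 Y1, D X1 Y2 - D Y1 X2))"

definition tangent_J :: "('a \<Rightarrow> 'a) \<Rightarrow> 'a \<times> 'a \<Rightarrow> 'a \<times> 'a" where
  "tangent_J J = (\<lambda>(X1, X2). (J X1, J X2))"

definition tangent_g :: "('a \<Rightarrow> 'a \<Rightarrow> real) \<Rightarrow> 'a \<times> 'a \<Rightarrow> 'a \<times> 'a \<Rightarrow> real" where
  "tangent_g g = (\<lambda>(X1, X2) (Y1, Y2). g X1 Y1 + g X2 Y2)"

lemma hermitian_tangent:
  assumes "hermitian_lie_algebra br J g" and "flat_connection br D"
    and DJ: "\<And>X Y. D X (J Y) = J (D X Y)"
  shows "hermitian_lie_algebra (tangent_br br D) (tangent_J J) (tangent_g g)"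
proof -
  interpret hermitian_lie_algebra br J g by fact
  have D: "bilinear D" and flat: "\<And>X Y Z. D X (D Y Z) - D Y (D X Z) = D (br X Y) Z"
    using assms(2) by (auto simp: flat_connection_def)
  have anti: "br X Y = - br Y X" for X Y
  proof -
    have "br X Y + br Y X = br (X + Y) (X + Y)"
      by (simp only: bilinear_ladd[OF bilinear_br] bilinear_radd[OF bilinear_br]) (simp add: br_self)
    then show ?thesis
      by (simp add: br_self eq_neg_iff_add_eq_0)
  qed
  note bl = bilinear_ladd bilinear_radd bilinear_lmul bilinear_rmul bilinear_lsub bilinear_rsub
    bilinear_lneg bilinear_rneg
  note B = bl[OF bilinear_br] bl[OF D] bl[OF bilinear_g]
  note L = linear_add[OF linear_J] linear_scale[OF linear_J] linear_diff[OF linear_J]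
    linear_neg[OF linear_J]
  have J': "J (br X Y) - J (br (J X) (J Y)) = br (J X) Y + br X (J Y)" for X Y
    using integrable_J[of X Y] by (simp add: L)
  have g0: "g X X \<ge> 0" for X
    using g_pos[of X] bilinear_lzero[OF bilinear_g, of X] by (cases "X = 0") auto
  show ?thesis
  proof (intro hermitian_lie_algebra.intro lie_algebra.intro hermitian_lie_algebra_axioms.intro)
    show "bilinear (tangent_br br D)"
      unfolding bilinear_def
      by (auto intro!: linearI simp: tangent_br_def split_beta B algebra_simps)
    show "bilinear (tangent_g g)"
      unfolding bilinear_def
      by (auto intro!: linearI simp: tangent_g_def split_beta B algebra_simps)
    show "linear (tangent_J J)"
      by (auto intro!: linearI simp: tangent_J_def split_beta L)
  next
    fix X Y Z :: "'a \<times> 'a"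
    show "tangent_br br D X X = 0"
      by (auto simp: tangent_br_def split_beta br_self zero_prod_def)
    show "tangent_br br D X (tangent_br br D Y Z) + tangent_br br D Y (tangent_br br D Z X) +
        tangent_br br D Z (tangent_br br D X Y) = 0"
      by (auto simp: tangent_br_def split_beta jacobi zero_prod_def B flat[symmetric])
    show "tangent_J J (tangent_J J X) = - X"
      by (auto simp: tangent_J_def split_beta J_J prod_eq_iff)
    show "tangent_J J (tangent_br br D X Y - tangent_br br D (tangent_J J X) (tangent_J J Y)) -
      (tangent_br br D (tangent_J J X) Y + tangent_br br D X (tangent_J J Y)) = 0"
      by (auto simp: tangent_J_def tangent_br_def split_beta J_J prod_eq_iff L DJ J' B)
    show "tangent_g g X Y = tangent_g g Y X"
      by (auto simp: tangent_g_def split_beta g_sym)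
    show "tangent_g g (tangent_J J X) (tangent_J J Y) = tangent_g g X Y"
      by (auto simp: tangent_g_def tangent_J_def split_beta g_J)
    show "0 < tangent_g g X X" if "X \<noteq> 0"
      using that g0[of "fst X"] g0[of "snd X"] g_pos[of "fst X"] g_pos[of "snd X"]
      by (cases "fst X = 0") (auto simp: tangent_g_def split_beta prod_eq_iff intro: add_pos_nonneg add_nonneg_pos)
  qed
qed

end

theory Submission
  imports Defs
begin

text \<open>
  Both projections of \<open>\<gg> \<oplus> \<gg>\<close> onto \<open>\<gg>\<close> commute with the complex structures, and the first
  one is a homomorphism of Lie algebras. The fundamental form of the tangent algebra is the sum
  of the pullbacks of \<open>\<omega>\<close> along the two projections. The second summand is closed because
  \<open>D\<close> preserves \<open>g\<close> and \<open>J\<close>, and on the first one \<open>d\<close> and the projections onto types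
  commute with the pullback. Hence \<open>\<partial>\<close> after \<open>\<partial>\<close>-bar of the new fundamental form is the
  pullback of the same form on \<open>\<gg>\<close> along a surjection.
\<close>

section \<open>Multilinear and alternating forms\<close>

definition multilinear_form :: "nat \<Rightarrow> ('a::real_vector) form \<Rightarrow> bool" where
  "multilinear_form k \<alpha> \<longleftrightarrow> (\<forall>xs. length xs \<noteq> k \<longrightarrow> \<alpha> xs = 0) \<and>
     (\<forall>xs i. length xs = k \<longrightarrow> i < k \<longrightarrow> linear (\<lambda>x. \<alpha> (xs[i := x])))"

text \<open>Alternation is encoded as vanishing on repeated arguments, a condition without signs;
  the sign rule for permutations is derived from it by polarization.\<close>

definition alternating_form :: "nat \<Rightarrow> ('a::real_vector) form \<Rightarrow> bool" where
  "alternating_form k \<alpha> \<longleftrightarrow> multilinear_form k \<alpha> \<and> (\<forall>xs. \<not> distinct xs \<longrightarrow> \<alpha> xs = 0)"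

lemma multilinear_form_length: "multilinear_form k \<alpha> \<Longrightarrow> length xs \<noteq> k \<Longrightarrow> \<alpha> xs = 0"
  by (simp add: multilinear_form_def)

lemma multilinear_form_linear:
  "multilinear_form k \<alpha> \<Longrightarrow> length xs = k \<Longrightarrow> i < k \<Longrightarrow> linear (\<lambda>x. \<alpha> (xs[i := x]))"
  by (simp add: multilinear_form_def)

lemma alternating_form_multilinear: "alternating_form k \<alpha> \<Longrightarrow> multilinear_form k \<alpha>"
  by (simp add: alternating_form_def)

lemma alternating_form_not_distinct: "alternating_form k \<alpha> \<Longrightarrow> \<not> distinct xs \<Longrightarrow> \<alpha> xs = 0"
  by (simp add: alternating_form_def)

lemma alternating_form_zero: "alternating_form k (\<lambda>_. 0)"
  by (simp add: alternating_form_def multilinear_form_def linear_zero)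

lemma alternating_form_add:
  "alternating_form k \<alpha> \<Longrightarrow> alternating_form k \<beta> \<Longrightarrow> alternating_form k (\<lambda>xs. \<alpha> xs + \<beta> xs)"
  by (auto simp: alternating_form_def multilinear_form_def intro!: linear_compose_add)

lemma linear_cmult:
  fixes f :: "'a::real_vector \<Rightarrow> complex"
  assumes "linear f"
  shows "linear (\<lambda>x. c * f x)"
  by (rule linearI) (simp_all add: linear_add[OF assms] linear_scale[OF assms] algebra_simps)

lemma alternating_form_scale:
  "alternating_form k \<alpha> \<Longrightarrow> alternating_form k (\<lambda>xs. c * \<alpha> xs)"
  by (auto simp: alternating_form_def multilinear_form_def intro!: linear_cmult)

text \<open>Polarization: with all other slots frozen, \<open>F\<close> is bilinear in slots
  \<open>a\<close> and \<open>b\<close> and vanishes on the diagonal. Expanding it at the sum of the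
  two entries leaves only the mixed terms.\<close>

lemma alternating_form_transpose:
  assumes \<alpha>: "alternating_form k \<alpha>" and len: "length xs = k"
    and ab: "a < k" "b < k" "a \<noteq> b"
  shows "\<alpha> (permute_list (Transposition.transpose a b) xs) = - \<alpha> xs"
proof -
  define F where "F = (\<lambda>x y. \<alpha> (xs[a := x, b := y]))"
  have l1: "linear (\<lambda>x. F x y)" for y
    using multilinear_form_linear[OF alternating_form_multilinear[OF \<alpha>], of "xs[b := y]" a] ab len
    by (simp add: F_def list_update_swap[of a b])
  have l2: "linear (F x)" for x
    using multilinear_form_linear[OF alternating_form_multilinear[OF \<alpha>], of "xs[a := x]" b] ab len
    by (simp add: F_def)
  have diag: "F x x = 0" for x
  proof -
    have "xs[a := x, b := x] ! a = xs[a := x, b := x] ! b"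
      using ab len by simp
    then have "\<not> distinct (xs[a := x, b := x])"
      using ab len by (subst distinct_conv_nth) (auto simp del: nth_list_update_eq nth_list_update_neq)
    then show ?thesis
      unfolding F_def by (rule alternating_form_not_distinct[OF \<alpha>])
  qed
  have "0 = F (xs ! a + xs ! b) (xs ! a + xs ! b)"
    by (simp add: diag)
  also have "\<dots> = F (xs ! a) (xs ! b) + F (xs ! b) (xs ! a)"
    by (simp only: linear_add[OF l1] linear_add[OF l2]) (simp add: diag)
  finally have "F (xs ! b) (xs ! a) = - F (xs ! a) (xs ! b)"
    by (simp add: eq_neg_iff_add_eq_0 add.commute)
  moreover have "permute_list (Transposition.transpose a b) xs = xs[a := xs ! b, b := xs ! a]"
    using ab len by (intro nth_equalityI) (auto simp: permute_list_def nth_list_update Transposition.transpose_def)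
  ultimately show ?thesis
    using ab by (simp add: F_def list_update_swap)
qed

text \<open>Permutations are built up from transpositions. Composing on the right makes the new
  transposition act on the list that is already permuted, so each step costs one sign.\<close>

lemma alternating_form_permute:
  assumes \<alpha>: "alternating_form k \<alpha>" and \<sigma>: "\<sigma> permutes {..<k}" and len: "length xs = k"
  shows "\<alpha> (permute_list \<sigma> xs) = of_int (sign \<sigma>) * \<alpha> xs"
  using finite_lessThan \<sigma>
proof (induction \<sigma> rule: permutes_rev_induct)
  case id
  show ?case by simp
next
  case (swap a b p)
  have t: "Transposition.transpose a b permutes {..<k}"
    using swap by (auto intro: permutes_swap_id)
  have "\<alpha> (permute_list (p \<circ> Transposition.transpose a b) xs) = \<alpha> (permute_list (Transposition.transpose a b) (permute_list p xs))"
    using t len by (subst permute_list_compose) auto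
  also have "\<dots> = - \<alpha> (permute_list p xs)"
    using swap len by (intro alternating_form_transpose[OF \<alpha>]) auto
  also have "\<dots> = of_int (sign (p \<circ> Transposition.transpose a b)) * \<alpha> xs"
  proof -
    have "permutation p" "permutation (Transposition.transpose a b)"
      using swap t by (auto intro: permutes_imp_permutation)
    then show ?thesis
      using swap by (simp add: sign_compose sign_swap_id)
  qed
  finally show ?case .
qed

section \<open>Wedge products of covectors\<close>

text \<open>Substituting \<open>\<sigma> \<circ> \<tau>\<close> for \<open>\<sigma>\<close> and
  reindexing each product by \<open>\<tau>\<close> moves the permutation out of the covectors at the
  cost of \<open>sign \<tau>\<close>. This later allows sorting the factors by type.\<close>

lemma wedge_permute_list:
  assumes \<tau>: "\<tau> permutes {..<length \<theta>s}"
  shows "wedge (permute_list \<tau> \<theta>s) = (\<lambda>xs. of_int (sign \<tau>) * wedge \<theta>s xs)"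
proof
  fix xs :: "'a list"
  let ?n = "length \<theta>s"
  have p\<tau>: "permutation \<tau>"
    using \<tau> by (auto intro: permutes_imp_permutation)
  have "(\<Sum>\<sigma> | \<sigma> permutes {..<?n}. of_int (sign \<sigma>) * (\<Prod>i<?n. (permute_list \<tau> \<theta>s ! i) (xs ! \<sigma> i)))
    = (\<Sum>\<sigma> | \<sigma> permutes {..<?n}. of_int (sign (\<sigma> \<circ> \<tau>)) *
         (\<Prod>i<?n. (permute_list \<tau> \<theta>s ! i) (xs ! (\<sigma> \<circ> \<tau>) i)))"
    by (rule sum_permutations_compose_right[OF \<tau>])
  also have "\<dots> = (\<Sum>\<sigma> | \<sigma> permutes {..<?n}. of_int (sign \<tau>) *
      (of_int (sign \<sigma>) * (\<Prod>i<?n. (\<theta>s ! i) (xs ! \<sigma> i))))"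
  proof (rule sum.cong[OF refl])
    fix \<sigma> assume "\<sigma> \<in> {\<sigma>. \<sigma> permutes {..<?n}}"
    then have p: "permutation \<sigma>"
      by (auto intro: permutes_imp_permutation)
    have "(\<Prod>i<?n. (permute_list \<tau> \<theta>s ! i) (xs ! (\<sigma> \<circ> \<tau>) i)) = (\<Prod>i<?n. (\<theta>s ! \<tau> i) (xs ! \<sigma> (\<tau> i)))"
      by (simp add: permute_list_nth[OF \<tau>])
    also have "\<dots> = (\<Prod>i<?n. (\<theta>s ! i) (xs ! \<sigma> i))"
      using prod.permute[OF \<tau>, of "\<lambda>i. (\<theta>s ! i) (xs ! \<sigma> i)"] by (simp add: o_def)
    finally show "of_int (sign (\<sigma> \<circ> \<tau>)) * (\<Prod>i<?n. (permute_list \<tau> \<theta>s ! i) (xs ! (\<sigma> \<circ> \<tau>) i))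
        = of_int (sign \<tau>) * (of_int (sign \<sigma>) * (\<Prod>i<?n. (\<theta>s ! i) (xs ! \<sigma> i)))"
      using p p\<tau> by (simp add: sign_compose)
  qed
  finally show "wedge (permute_list \<tau> \<theta>s) xs = of_int (sign \<tau>) * wedge \<theta>s xs"
    by (simp add: wedge_def sum_distrib_left)
qed

lemma wedge_add:
  "wedge (\<theta>s @ (\<lambda>x. a x + b x) # \<eta>s) = (\<lambda>xs. wedge (\<theta>s @ a # \<eta>s) xs + wedge (\<theta>s @ b # \<eta>s) xs)"
proof
  fix xs :: "'a list"
  let ?m = "length \<theta>s" and ?n = "Suc (length \<theta>s + length \<eta>s)"
  \<comment> \<open>The product over all factors but the one in slot \<open>?m\<close>. That slot is
    left out, so the same \<open>R\<close> serves for \<open>a\<close>, \<open>b\<close> and their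
    sum.\<close>
  define R where "R \<sigma> = (\<Prod>i\<in>{..<?n} - {?m}. ((\<theta>s @ a # \<eta>s) ! i) (xs ! \<sigma> i))" for \<sigma>
  have *: "(\<Prod>i<?n. ((\<theta>s @ c # \<eta>s) ! i) (xs ! \<sigma> i)) = c (xs ! \<sigma> ?m) * R \<sigma>" for c and \<sigma> :: "nat \<Rightarrow> nat"
  proof -
    have "(\<Prod>i<?n. ((\<theta>s @ c # \<eta>s) ! i) (xs ! \<sigma> i)) =
        c (xs ! \<sigma> ?m) * (\<Prod>i\<in>{..<?n} - {?m}. ((\<theta>s @ c # \<eta>s) ! i) (xs ! \<sigma> i))"
      by (subst prod.remove[of _ ?m]) auto
    also have "(\<Prod>i\<in>{..<?n} - {?m}. ((\<theta>s @ c # \<eta>s) ! i) (xs ! \<sigma> i)) = R \<sigma>"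
      unfolding R_def by (rule prod.cong) (auto simp: nth_append nth_Cons')
    finally show ?thesis .
  qed
  show "wedge (\<theta>s @ (\<lambda>x. a x + b x) # \<eta>s) xs = wedge (\<theta>s @ a # \<eta>s) xs + wedge (\<theta>s @ b # \<eta>s) xs"
    by (simp add: wedge_def * sum.distrib[symmetric] distrib_left distrib_right del: prod.lessThan_Suc)
qed

text \<open>Each argument enters exactly one factor of each product, which gives linearity. If two
  arguments agree, swapping them changes only the signs of the permutations, so the sum equals its
  own negative.\<close>

lemma alternating_form_wedge:
  assumes lin: "\<forall>\<theta>\<in>set \<theta>s. linear \<theta>"
  shows "alternating_form (length \<theta>s) (wedge \<theta>s)"
proof -
  let ?n = "length \<theta>s"
  have "linear (\<lambda>x. wedge \<theta>s (xs[i := x]))" if len: "length xs = ?n" and i: "i < ?n" for xs i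
  proof -
    have "linear (\<lambda>x. \<Prod>j<?n. (\<theta>s ! j) (xs[i := x] ! \<sigma> j))" if \<sigma>: "\<sigma> permutes {..<?n}" for \<sigma>
    proof -
      \<comment> \<open>\<open>m\<close> is the position of the only factor that is evaluated at
        argument \<open>i\<close>.\<close>
      obtain m where m: "m < ?n" "\<sigma> m = i"
        using permutes_image[OF \<sigma>] i by (metis imageE lessThan_iff)
      have inj: "\<sigma> j = i \<longleftrightarrow> j = m" for j
        using permutes_inj[OF \<sigma>] m by (auto dest: injD)
      have "(\<Prod>j<?n. (\<theta>s ! j) (xs[i := x] ! \<sigma> j)) =
          (\<Prod>j\<in>{..<?n} - {m}. (\<theta>s ! j) (xs ! \<sigma> j)) * (\<theta>s ! m) x" for x
      proof -
        have "(\<Prod>j\<in>{..<?n} - {m}. (\<theta>s ! j) (xs[i := x] ! \<sigma> j)) =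
            (\<Prod>j\<in>{..<?n} - {m}. (\<theta>s ! j) (xs ! \<sigma> j))"
        proof (rule prod.cong[OF refl])
          fix j assume "j \<in> {..<?n} - {m}"
          then have "\<sigma> j \<noteq> i"
            using inj by simp
          then show "(\<theta>s ! j) (xs[i := x] ! \<sigma> j) = (\<theta>s ! j) (xs ! \<sigma> j)"
            by simp
        qed
        then show ?thesis
          using m i len by (subst prod.remove[of _ m]) auto
      qed
      moreover have "linear (\<theta>s ! m)"
        using lin m by simp
      ultimately show ?thesis
        by (simp add: linear_cmult)
    qed
    then show ?thesis
      using len by (auto simp: wedge_def intro!: linear_compose_sum linear_cmult)
  qed
  moreover have "wedge \<theta>s xs = 0" if nd: "\<not> distinct xs" for xs
  proof (cases "length xs = ?n")
    case True
    obtain a b where ab: "a < ?n" "b < ?n" "a \<noteq> b" "xs ! a = xs ! b"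
      using nd True by (auto simp: distinct_conv_nth)
    have t: "Transposition.transpose a b permutes {..<?n}"
      using ab by (auto intro: permutes_swap_id)
    have x: "xs ! Transposition.transpose a b i = xs ! i" for i
      using ab by (auto simp: Transposition.transpose_def)
    let ?f = "\<lambda>\<sigma>. of_int (sign \<sigma>) * (\<Prod>i<?n. (\<theta>s ! i) (xs ! \<sigma> i))"
    have "(\<Sum>\<sigma> | \<sigma> permutes {..<?n}. ?f \<sigma>) = (\<Sum>\<sigma> | \<sigma> permutes {..<?n}. ?f (Transposition.transpose a b \<circ> \<sigma>))"
      by (rule setum_permutations_compose_left[OF t])
    also have "\<dots> = (\<Sum>\<sigma> | \<sigma> permutes {..<?n}. - ?f \<sigma>)"
    proof (rule sum.cong[OF refl])
      fix \<sigma> assume "\<sigma> \<in> {\<sigma>. \<sigma> permutes {..<?n}}"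
      then have "permutation \<sigma>" "permutation (Transposition.transpose a b)"
        using t by (auto intro: permutes_imp_permutation)
      then show "?f (Transposition.transpose a b \<circ> \<sigma>) = - ?f \<sigma>"
        using ab by (simp add: sign_compose sign_swap_id x)
    qed
    finally show ?thesis
      using True by (simp add: wedge_def sum_negf)
  qed (simp add: wedge_def)
  ultimately show ?thesis
    by (simp add: alternating_form_def multilinear_form_def wedge_def)
qed

section \<open>Expansion of forms in a basis\<close>

lemma multilinear_form_Cons:
  assumes "multilinear_form (Suc k) \<alpha>"
  shows "multilinear_form k (\<lambda>xs. \<alpha> (x # xs))"
  unfolding multilinear_form_def
proof (intro conjI allI impI)
  fix xs :: "'a list" and i assume "length xs = k" "i < k"
  then show "linear (\<lambda>y. \<alpha> (x # xs[i := y]))"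
    using multilinear_form_linear[OF assms, of "x # xs" "Suc i"] by simp
qed (use assms in \<open>simp add: multilinear_form_def\<close>)

text \<open>Induction on the degree: the first argument is expanded in the basis, and the induction
  hypothesis is applied to the form with a basis vector fixed in front.\<close>

lemma multilinear_form_expansion:
  assumes \<alpha>: "multilinear_form k \<alpha>" and B: "finite B" "independent B" "span B = UNIV"
    and len: "length xs = k"
  shows "\<alpha> xs = (\<Sum>bs | set bs \<subseteq> B \<and> length bs = k.
    (\<Prod>i<k. complex_of_real (representation B (xs ! i) (bs ! i))) * \<alpha> bs)"
  using \<alpha> len
proof (induction k arbitrary: \<alpha> xs)
  case 0
  then have "{bs. set bs \<subseteq> B \<and> length bs = 0} = {[]}" "xs = []"
    by auto
  then show ?case by simp
next
  case (Suc k)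
  then obtain x ys where xs: "xs = x # ys" "length ys = k"
    by (auto simp: length_Suc_conv)
  let ?r = "\<lambda>x b. complex_of_real (representation B x b)"
  let ?L = "{bs. set bs \<subseteq> B \<and> length bs = k}"
  have lin: "linear (\<lambda>x. \<alpha> (x # ys))"
    using multilinear_form_linear[OF Suc.prems(1), of "x # ys" 0] xs by simp
  have "\<alpha> xs = \<alpha> ((\<Sum>b\<in>B. representation B x b *\<^sub>R b) # ys)"
    using B by (simp add: xs real_vector.sum_representation_eq)
  also have "\<dots> = (\<Sum>b\<in>B. ?r x b * \<alpha> (b # ys))"
    by (simp add: linear_sum[OF lin] linear_scale[OF lin] scaleR_conv_of_real)
  also have "\<dots> = (\<Sum>b\<in>B. ?r x b * (\<Sum>bs\<in>?L. (\<Prod>i<k. ?r (ys ! i) (bs ! i)) * \<alpha> (b # bs)))"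
    using Suc.IH[OF multilinear_form_Cons[OF Suc.prems(1)]] xs by simp
  also have "\<dots> = (\<Sum>b\<in>B. \<Sum>bs\<in>?L. (\<Prod>i<Suc k. ?r (xs ! i) ((b # bs) ! i)) * \<alpha> (b # bs))"
    unfolding prod.lessThan_Suc_shift by (simp add: xs sum_distrib_left mult.assoc)
  also have "\<dots> = (\<Sum>bs\<in>?L. \<Sum>b\<in>B. (\<Prod>i<Suc k. ?r (xs ! i) ((b # bs) ! i)) * \<alpha> (b # bs))"
    by (rule sum.swap)
  also have "\<dots> = (\<Sum>(bs, b)\<in>?L \<times> B. (\<Prod>i<Suc k. ?r (xs ! i) ((b # bs) ! i)) * \<alpha> (b # bs))"
    by (rule sum.cartesian_product)
  also have "\<dots> = (\<Sum>bs | set bs \<subseteq> B \<and> length bs = Suc k. (\<Prod>i<Suc k. ?r (xs ! i) (bs ! i)) * \<alpha> bs)"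
    unfolding lists_length_Suc_eq
    by (subst sum.reindex) (auto simp: inj_split_Cons o_def split_beta intro!: sum.cong)
  finally show ?case .
qed

text \<open>Averaging the basis expansion over all permutations of the arguments produces wedges.\<close>

lemma alternating_form_expansion:
  assumes \<alpha>: "alternating_form k \<alpha>" and B: "finite B" "independent B" "span B = UNIV"
  shows "\<alpha> = (\<lambda>xs. \<Sum>bs | set bs \<subseteq> B \<and> length bs = k. (\<alpha> bs / of_nat (fact k)) *
     wedge (map (\<lambda>b x. complex_of_real (representation B x b)) bs) xs)"
proof
  fix xs :: "'a list"
  let ?r = "\<lambda>b x. complex_of_real (representation B x b)"
  let ?L = "{bs. set bs \<subseteq> B \<and> length bs = k}"
  let ?P = "{\<sigma>. \<sigma> permutes {..<k}}"
  show "\<alpha> xs = (\<Sum>bs\<in>?L. (\<alpha> bs / of_nat (fact k)) * wedge (map ?r bs) xs)"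
  proof (cases "length xs = k")
    case True
    have "of_nat (fact k) * \<alpha> xs = (\<Sum>\<sigma>\<in>?P. \<alpha> xs)"
      by (simp add: card_permutations)
    \<comment> \<open>A sign squares to 1, so undoing the permutation of the arguments costs the
      same sign again.\<close>
    also have "\<dots> = (\<Sum>\<sigma>\<in>?P. of_int (sign \<sigma>) * \<alpha> (permute_list \<sigma> xs))"
      using alternating_form_permute[OF \<alpha> _ True]
      by (intro sum.cong) (auto simp: mult.assoc[symmetric] of_int_mult[symmetric] simp del: of_int_mult)
    also have "\<dots> = (\<Sum>\<sigma>\<in>?P. \<Sum>bs\<in>?L. \<alpha> bs * (of_int (sign \<sigma>) * (\<Prod>i<k. ?r (bs ! i) (xs ! \<sigma> i))))"
    proof (rule sum.cong[OF refl])
      fix \<sigma> assume "\<sigma> \<in> ?P"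
      then have *: "permute_list \<sigma> xs ! i = xs ! \<sigma> i" if "i < k" for i
        using True that by (intro permute_list_nth) auto
      show "of_int (sign \<sigma>) * \<alpha> (permute_list \<sigma> xs) =
          (\<Sum>bs\<in>?L. \<alpha> bs * (of_int (sign \<sigma>) * (\<Prod>i<k. ?r (bs ! i) (xs ! \<sigma> i))))"
        using True by (subst multilinear_form_expansion[OF alternating_form_multilinear[OF \<alpha>] B])
          (auto simp: * sum_distrib_left algebra_simps)
    qed
    also have "\<dots> = (\<Sum>bs\<in>?L. \<alpha> bs * (\<Sum>\<sigma>\<in>?P. of_int (sign \<sigma>) * (\<Prod>i<k. ?r (bs ! i) (xs ! \<sigma> i))))"
      by (subst sum.swap) (simp add: sum_distrib_left)
    also have "\<dots> = (\<Sum>bs\<in>?L. \<alpha> bs * wedge (map ?r bs) xs)"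
      using True by (intro sum.cong) (auto simp: wedge_def)
    finally have "\<alpha> xs = (\<Sum>bs\<in>?L. \<alpha> bs * wedge (map ?r bs) xs) / of_nat (fact k)"
      by (simp add: field_simps)
    then show ?thesis
      by (simp add: sum_divide_distrib)
  next
    case False
    then show ?thesis
      using multilinear_form_length[OF alternating_form_multilinear[OF \<alpha>], of xs]
      by (auto simp: wedge_def intro!: sum.neutral)
  qed
qed

section \<open>Existence of the decomposition into types\<close>

text \<open>The existence condition inside the description that defines \<open>type_part\<close>.
  Without it that description determines nothing, so it accompanies every later computation of a
  component.\<close>

definition splits_by_type :: "('a::real_vector \<Rightarrow> 'a) \<Rightarrow> nat \<Rightarrow> 'a form \<Rightarrow> bool" where
  "splits_by_type J k \<alpha> \<longleftrightarrow>
     (\<exists>\<gamma>. (\<forall>r\<le>k. \<gamma> r \<in> forms_pq J r (k - r)) \<and> \<alpha> = (\<lambda>xs. \<Sum>r\<le>k. \<gamma> r xs))"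

lemma splits_by_type_forms_pq:
  assumes "\<alpha> \<in> forms_pq J p q"
  shows "splits_by_type J (p + q) \<alpha>"
  unfolding splits_by_type_def
proof (intro exI conjI allI impI)
  show "(\<lambda>xs. if r = p then \<alpha> xs else 0) \<in> forms_pq J r (p + q - r)" for r
    using assms by (cases "r = p") (auto intro: forms_pq.zero)
qed simp

lemma splits_by_type_zero: "splits_by_type J k (\<lambda>_. 0)"
  using splits_by_type_forms_pq[OF forms_pq.zero, of J k 0] by simp

lemma splits_by_type_add:
  assumes "splits_by_type J k \<alpha>" "splits_by_type J k \<beta>"
  shows "splits_by_type J k (\<lambda>xs. \<alpha> xs + \<beta> xs)"
proof -
  obtain \<gamma> \<delta> where "\<forall>r\<le>k. \<gamma> r \<in> forms_pq J r (k - r)" "\<alpha> = (\<lambda>xs. \<Sum>r\<le>k. \<gamma> r xs)"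
    "\<forall>r\<le>k. \<delta> r \<in> forms_pq J r (k - r)" "\<beta> = (\<lambda>xs. \<Sum>r\<le>k. \<delta> r xs)"
    using assms by (auto simp: splits_by_type_def)
  then show ?thesis
    unfolding splits_by_type_def
    by (intro exI[of _ "\<lambda>r xs. \<gamma> r xs + \<delta> r xs"]) (auto simp: sum.distrib intro: forms_pq.add)
qed

lemma splits_by_type_scale:
  assumes "splits_by_type J k \<alpha>"
  shows "splits_by_type J k (\<lambda>xs. c * \<alpha> xs)"
proof -
  obtain \<gamma> where "\<forall>r\<le>k. \<gamma> r \<in> forms_pq J r (k - r)" "\<alpha> = (\<lambda>xs. \<Sum>r\<le>k. \<gamma> r xs)"
    using assms by (auto simp: splits_by_type_def)
  then show ?thesis
    unfolding splits_by_type_def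
    by (intro exI[of _ "\<lambda>r xs. c * \<gamma> r xs"]) (auto simp: sum_distrib_left intro: forms_pq.scale)
qed

lemma splits_by_type_sum:
  "(\<And>b. b \<in> S \<Longrightarrow> splits_by_type J k (\<alpha> b)) \<Longrightarrow> splits_by_type J k (\<lambda>xs. \<Sum>b\<in>S. \<alpha> b xs)"
  by (induction S rule: infinite_finite_induct)
    (auto intro: splits_by_type_zero splits_by_type_add)

text \<open>Sorting the factors so that those of type (1,0) come first gives a generator of some
  \<open>forms_pq\<close>; the sorting permutation contributes only a sign.\<close>

lemma splits_by_type_wedge_pure:
  assumes "set \<theta>s \<subseteq> covectors10 J \<union> covectors01 J"
  shows "splits_by_type J (length \<theta>s) (wedge \<theta>s)"
proof -
  \<comment> \<open>The second block is the complement of the first, since the zero covector has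
    both types and must be counted once.\<close>
  let ?as = "filter (\<lambda>\<theta>. \<theta> \<in> covectors10 J) \<theta>s" and ?bs = "filter (\<lambda>\<theta>. \<theta> \<notin> covectors10 J) \<theta>s"
  have "mset \<theta>s = mset (?as @ ?bs)"
    by simp
  then obtain \<tau> where \<tau>: "\<tau> permutes {..<length (?as @ ?bs)}" "permute_list \<tau> (?as @ ?bs) = \<theta>s"
    by (rule mset_eq_permutation)
  have "wedge (?as @ ?bs) \<in> forms_pq J (length ?as) (length ?bs)"
    using assms by (intro forms_pq.wedge) auto
  then have "splits_by_type J (length ?as + length ?bs) (wedge \<theta>s)"
    using splits_by_type_scale[OF splits_by_type_forms_pq]
      wedge_permute_list[OF \<tau>(1), unfolded \<tau>(2)] by metis
  then show ?thesis
    by (simp add: sum_length_filter_compl)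
qed

text \<open>Composition with \<open>J\<close> squares to -1 on covectors; the two summands are the
  projections of \<open>\<theta>\<close> to its eigenspaces for \<open>\<i>\<close> and
  \<open>- \<i>\<close>.\<close>

lemma covector_split:
  assumes "linear \<theta>" "linear J" "\<And>X. J (J X) = - X"
  obtains a b where "a \<in> covectors10 J" "b \<in> covectors01 J" "\<theta> = (\<lambda>X. a X + b X)"
proof
  have J\<theta>: "linear (\<lambda>X. \<theta> (J X))"
    using linear_compose[OF assms(2,1)] by (simp add: o_def)
  have lin: "linear (\<lambda>X. 1/2 * (\<theta> X + c * \<theta> (J X)))" for c
    by (intro linear_cmult linear_compose_add assms J\<theta>)
  show "(\<lambda>X. 1/2 * (\<theta> X + - \<i> * \<theta> (J X))) \<in> covectors10 J"
    using assms lin[of "- \<i>"] by (simp add: covectors10_def linear_neg algebra_simps)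
  show "(\<lambda>X. 1/2 * (\<theta> X + \<i> * \<theta> (J X))) \<in> covectors01 J"
    using assms lin[of "\<i>"] by (simp add: covectors01_def linear_neg algebra_simps)
  show "\<theta> = (\<lambda>X. 1/2 * (\<theta> X + - \<i> * \<theta> (J X)) + 1/2 * (\<theta> X + \<i> * \<theta> (J X)))"
    by (auto simp: algebra_simps)
qed

lemma splits_by_type_wedge:
  assumes J: "linear J" "\<And>X. J (J X) = - X" and "\<forall>\<theta>\<in>set \<theta>s. linear \<theta>"
  shows "splits_by_type J (length \<theta>s) (wedge \<theta>s)"
proof -
  \<comment> \<open>Generalization for the induction: the factors in \<open>as\<close> are already
    of pure type. The head of \<open>bs\<close> is split in two, and either half is moved to the end
    of \<open>as\<close>.\<close>
  have "splits_by_type J (length (as @ bs)) (wedge (as @ bs))"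
    if "set as \<subseteq> covectors10 J \<union> covectors01 J" "\<forall>\<theta>\<in>set bs. linear \<theta>" for as bs
    using that
  proof (induction bs arbitrary: as)
    case Nil
    then show ?case
      using splits_by_type_wedge_pure by fastforce
  next
    case (Cons \<theta> bs)
    obtain a b where ab: "a \<in> covectors10 J" "b \<in> covectors01 J" and \<theta>: "\<theta> = (\<lambda>X. a X + b X)"
      using covector_split[of \<theta> J] Cons.prems J by auto
    have "splits_by_type J (length ((as @ [c]) @ bs)) (wedge ((as @ [c]) @ bs))"
      if "c \<in> {a, b}" for c
      using that ab Cons.prems by (intro Cons.IH) auto
    from this[of a] this[of b] show ?case
      using splits_by_type_add by (fastforce simp: \<theta> wedge_add)
  qed
  from this[of "[]" \<theta>s] show ?thesis
    using assms by simp
qed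

text \<open>The basis expansion writes the form as a combination of wedges of real coordinate
  covectors, and each of these wedges splits.\<close>

lemma splits_by_type_alternating:
  fixes J :: "'a::real_vector \<Rightarrow> 'a" and B :: "'a set"
  assumes J: "linear J" "\<And>X. J (J X) = - X" and B: "finite B" "span B = UNIV"
    and \<alpha>: "alternating_form k \<alpha>"
  shows "splits_by_type J k \<alpha>"
proof -
  \<comment> \<open>\<open>B\<close> spans but may be dependent, and coordinates need a
    basis.\<close>
  obtain C where C: "C \<subseteq> B" "independent C" "B \<subseteq> span C"
    by (rule maximal_independent_subset)
  have "span C = UNIV"
    using span_mono[OF C(3)] B(2) by (simp add: span_span top.extremum_unique)
  with C B have C': "finite C" "independent C" "span C = UNIV"
    by (auto intro: finite_subset)
  have lin: "linear (\<lambda>x. complex_of_real (representation C x b))" for b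
    using C' by (intro linearI)
      (simp_all add: real_vector.representation_add real_vector.representation_scale scaleR_conv_of_real)
  show ?thesis
  proof (subst alternating_form_expansion[OF \<alpha> C'], intro splits_by_type_sum splits_by_type_scale)
    fix bs assume "bs \<in> {bs. set bs \<subseteq> C \<and> length bs = k}"
    then show "splits_by_type J k (wedge (map (\<lambda>b x. complex_of_real (representation C x b)) bs))"
      using splits_by_type_wedge[OF J, of "map (\<lambda>b x. complex_of_real (representation C x b)) bs"] lin
      by simp
  qed
qed

section \<open>Uniqueness of the decomposition into types\<close>

lemma prod_if_less:
  fixes a b :: complex
  shows "(\<Prod>i<p + q. if i < p then a else b) = a ^ p * b ^ q"
  by (induction q) (simp_all add: algebra_simps)

text \<open>A covector of type (1,0) picks up the factor \<open>cis t\<close> under the rotation,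
  one of type (0,1) the factor \<open>cis (- t)\<close>, and a wedge collects the factors of its
  covectors.\<close>

lemma forms_pq_rotation:
  assumes "\<alpha> \<in> forms_pq J p q"
  shows "\<alpha> (map (\<lambda>x. cos t *\<^sub>R x + sin t *\<^sub>R J x) xs) = cis t ^ p * cis (- t) ^ q * \<alpha> xs"
  using assms
proof (induction arbitrary: xs)
  case (wedge \<theta>s \<eta>s)
  let ?R = "\<lambda>x. cos t *\<^sub>R x + sin t *\<^sub>R J x"
  have a: "\<theta> (?R x) = cis t * \<theta> x" if "\<theta> \<in> covectors10 J" for \<theta> x
    using that by (auto simp: covectors10_def linear_add linear_scale complex_eq_iff algebra_simps)
  have b: "\<theta> (?R x) = cis (- t) * \<theta> x" if "\<theta> \<in> covectors01 J" for \<theta> x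
    using that by (auto simp: covectors01_def linear_add linear_scale complex_eq_iff algebra_simps)
  show ?case
  proof (cases "length xs = p + q")
    case True
    \<comment> \<open>The scalar of factor \<open>i\<close> depends on the covector in place
      \<open>i\<close> and not on the argument it receives, so the total is the same for every
      \<open>\<sigma>\<close>.\<close>
    have "(\<Prod>i<p + q. ((\<theta>s @ \<eta>s) ! i) (map ?R xs ! \<sigma> i)) =
        cis t ^ p * cis (- t) ^ q * (\<Prod>i<p + q. ((\<theta>s @ \<eta>s) ! i) (xs ! \<sigma> i))"
      if \<sigma>: "\<sigma> permutes {..<p + q}" for \<sigma>
    proof -
      have "((\<theta>s @ \<eta>s) ! i) (map ?R xs ! \<sigma> i) =
          (if i < p then cis t else cis (- t)) * ((\<theta>s @ \<eta>s) ! i) (xs ! \<sigma> i)" if i: "i < p + q" for i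
      proof -
        have "\<sigma> i < length xs"
          using permutes_in_image[OF \<sigma>, of i] i True by simp
        moreover have "\<theta>s ! i \<in> covectors10 J" if "i < p"
          using wedge that by (meson nth_mem subsetD)
        moreover have "\<eta>s ! (i - p) \<in> covectors01 J" if "\<not> i < p"
          using wedge that i by (metis add_diff_inverse_nat nat_add_left_cancel_less nth_mem subsetD)
        ultimately show ?thesis
          using wedge a b by (simp add: nth_append)
      qed
      then show ?thesis
        by (simp add: prod.distrib prod_if_less[symmetric])
    qed
    then show ?thesis
      using wedge True by (simp add: wedge_def sum_distrib_left algebra_simps)
  next
    case False
    then show ?thesis
      using wedge by (simp add: wedge_def)
  qed
qed (simp_all add: algebra_simps)

text \<open>
  The rotation \<open>cos t + sin t J\<close> acts on the component of type \<open>(r, k - r)\<close> as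
  \<open>cis t\<close> to the power \<open>2 r - k\<close>, so a vanishing sum of components gives a polynomial
  with infinitely many roots on the unit circle.
\<close>

lemma forms_pq_independent:
  assumes \<gamma>: "\<And>r. r \<le> k \<Longrightarrow> \<gamma> r \<in> forms_pq J r (k - r)"
    and zero: "\<And>xs. (\<Sum>r\<le>k. \<gamma> r xs) = 0" and "p \<le> k"
  shows "\<gamma> p = (\<lambda>_. 0)"
proof
  fix xs
  let ?Z = "{z. (\<Sum>r\<le>k. \<gamma> r xs * z ^ r) = 0}"
  have "cis (2 * t) \<in> ?Z" for t
  proof -
    \<comment> \<open>Multiplying by \<open>cis t ^ k\<close> clears the negative exponents:
      \<open>2 r - k\<close> becomes \<open>2 r\<close>.\<close>
    have *: "cis t ^ k * (cis t ^ r * cis (- t) ^ (k - r)) = cis (2 * t) ^ r" if "r \<le> k" for r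
    proof -
      obtain m where k: "k = r + m"
        using \<open>r \<le> k\<close> le_Suc_ex by blast
      have "cis t ^ k * (cis t ^ r * cis (- t) ^ (k - r)) = (cis t * cis t) ^ r * (cis t * cis (- t)) ^ m"
        by (simp add: k power_add power_mult_distrib del: cis_mult)
      also have "\<dots> = cis (2 * t) ^ r"
        unfolding cis_mult by simp
      finally show ?thesis .
    qed
    have "(\<Sum>r\<le>k. \<gamma> r xs * cis (2 * t) ^ r) =
        (\<Sum>r\<le>k. cis t ^ k * \<gamma> r (map (\<lambda>x. cos t *\<^sub>R x + sin t *\<^sub>R J x) xs))"
      by (intro sum.cong) (auto simp: forms_pq_rotation[OF \<gamma>] *[symmetric])
    also have "\<dots> = 0"
      by (simp add: sum_distrib_left[symmetric] zero)
    finally show ?thesis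
      by simp
  qed
  then have "(\<lambda>t. cis (2 * t)) ` {0..1/2} \<subseteq> ?Z"
    by auto
  \<comment> \<open>For \<open>t\<close> in this interval the angle \<open>2 * t\<close> stays in
    [0,1], hence within [0,pi], where the cosine is already injective.\<close>
  moreover have "infinite ((\<lambda>t. cis (2 * t)) ` {0..1/2})"
  proof
    assume "finite ((\<lambda>t. cis (2 * t)) ` {0..1/2})"
    moreover have "inj_on (\<lambda>t. cis (2 * t)) {0..1/2}"
    proof (rule inj_onI)
      fix s t :: real assume st: "s \<in> {0..1/2}" "t \<in> {0..1/2}" and "cis (2 * s) = cis (2 * t)"
      then have "cos (2 * s) = cos (2 * t)"
        by (metis cis.sel(1))
      moreover have "0 \<le> 2 * s" "2 * s \<le> pi" "0 \<le> 2 * t" "2 * t \<le> pi"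
        using st pi_gt3 by auto
      ultimately have "2 * s = 2 * t"
        by (rule cos_inj_pi[rotated 4])
      then show "s = t" by simp
    qed
    ultimately have "finite {0..1/2::real}"
      by (rule finite_imageD)
    then show False
      using infinite_Icc[of 0 "1/2::real"] by simp
  qed
  ultimately have "infinite ?Z"
    using infinite_super by blast
  then show "\<gamma> p xs = 0"
    using polyfun_finite_roots[of "\<lambda>r. \<gamma> r xs" k] \<open>p \<le> k\<close> by auto
qed

section \<open>Computing components of given type\<close>

text \<open>Two decompositions of the same form differ by one of zero, so independence makes the
  description unique. Any explicit decomposition may then be used to evaluate
  \<open>type_part\<close>.\<close>

lemma type_part_eq:
  assumes \<gamma>: "\<And>r. r \<le> p + q \<Longrightarrow> \<gamma> r \<in> forms_pq J r (p + q - r)"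
    and \<alpha>: "\<alpha> = (\<lambda>xs. \<Sum>r\<le>p + q. \<gamma> r xs)"
  shows "type_part J p q \<alpha> = \<gamma> p"
  unfolding type_part_def
proof (rule the_equality)
  show "\<exists>\<gamma>'. (\<forall>r\<le>p + q. \<gamma>' r \<in> forms_pq J r (p + q - r)) \<and> \<alpha> = (\<lambda>xs. \<Sum>r\<le>p + q. \<gamma>' r xs) \<and> \<gamma> p = \<gamma>' p"
    using assms by blast
next
  fix \<beta>
  assume "\<exists>\<gamma>'. (\<forall>r\<le>p + q. \<gamma>' r \<in> forms_pq J r (p + q - r)) \<and> \<alpha> = (\<lambda>xs. \<Sum>r\<le>p + q. \<gamma>' r xs) \<and> \<beta> = \<gamma>' p"
  then obtain \<gamma>' where \<gamma>': "\<And>r. r \<le> p + q \<Longrightarrow> \<gamma>' r \<in> forms_pq J r (p + q - r)"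
    "\<alpha> = (\<lambda>xs. \<Sum>r\<le>p + q. \<gamma>' r xs)" "\<beta> = \<gamma>' p"
    by blast
  \<comment> \<open>The difference is written with \<open>(- 1) *\<close> because the type spaces
    are closed under sums and scalings by construction.\<close>
  have "(\<lambda>xs. \<gamma>' p xs + (- 1) * \<gamma> p xs) = (\<lambda>_. 0)"
  proof (rule forms_pq_independent[of "p + q" "\<lambda>r xs. \<gamma>' r xs + (- 1) * \<gamma> r xs"])
    show "(\<Sum>r\<le>p + q. \<gamma>' r xs + (- 1) * \<gamma> r xs) = 0" for xs
      using fun_cong[OF \<gamma>'(2), of xs] by (simp add: \<alpha> sum_subtractf)
    show "(\<lambda>xs. \<gamma>' r xs + (- 1) * \<gamma> r xs) \<in> forms_pq J r (p + q - r)" if "r \<le> p + q" for r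
      using that by (intro forms_pq.add forms_pq.scale \<gamma> \<gamma>'(1))
  qed simp
  then show "\<beta> = \<gamma> p"
    by (simp add: \<gamma>'(3) fun_eq_iff)
qed

lemma type_part_in_forms_pq:
  assumes "splits_by_type J (p + q) \<alpha>"
  shows "type_part J p q \<alpha> \<in> forms_pq J p q"
proof -
  obtain \<gamma> where \<gamma>: "\<And>r. r \<le> p + q \<Longrightarrow> \<gamma> r \<in> forms_pq J r (p + q - r)"
      "\<alpha> = (\<lambda>xs. \<Sum>r\<le>p + q. \<gamma> r xs)"
    using assms by (auto simp: splits_by_type_def)
  show ?thesis
    using type_part_eq[OF \<gamma>] \<gamma>(1)[of p] by simp
qed

text \<open>A form of pure type is its own decomposition, with zero in all other places; as the
  total degrees agree, \<open>r = p\<close> also forces \<open>s = q\<close>.\<close>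

lemma type_part_forms_pq:
  assumes "\<alpha> \<in> forms_pq J r s" "r + s = p + q"
  shows "type_part J p q \<alpha> = (if r = p then \<alpha> else (\<lambda>_. 0))"
proof -
  have "type_part J p q \<alpha> = (\<lambda>r' xs. if r' = r then \<alpha> xs else 0) p"
  proof (rule type_part_eq)
    show "(\<lambda>xs. if r' = r then \<alpha> xs else 0) \<in> forms_pq J r' (p + q - r')" for r'
      using assms by (cases "r' = r") (auto intro: forms_pq.zero simp flip: assms(2))
    show "\<alpha> = (\<lambda>xs. \<Sum>r'\<le>p + q. if r' = r then \<alpha> xs else 0)"
      by (simp flip: assms(2))
  qed
  then show ?thesis
    by auto
qed

lemma type_part_zero: "type_part J p q (\<lambda>_. 0) = (\<lambda>_. 0)"
  using type_part_forms_pq[OF forms_pq.zero, of p q p q J] by simp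

section \<open>Pullbacks of typed forms\<close>

text \<open>Since \<open>\<pi>\<close> intertwines the complex structures, composing a covector with
  \<open>\<pi>\<close> keeps its type, and wedges pull back factor by factor.\<close>

lemma forms_pq_pullback:
  assumes \<pi>: "linear \<pi>" "\<And>x. \<pi> (J' x) = J (\<pi> x)" and "\<alpha> \<in> forms_pq J p q"
  shows "(\<lambda>xs. \<alpha> (map \<pi> xs)) \<in> forms_pq J' p q"
  using assms(3)
proof induction
  case (wedge \<theta>s \<eta>s)
  let ?f = "\<lambda>\<theta>. \<theta> \<circ> \<pi>"
  have "wedge (\<theta>s @ \<eta>s) (map \<pi> xs) = wedge (map ?f \<theta>s @ map ?f \<eta>s) xs" for xs
  proof (cases "length xs = p + q")
    case True
    have "((\<theta>s @ \<eta>s) ! i) (map \<pi> xs ! \<sigma> i) = (map ?f (\<theta>s @ \<eta>s) ! i) (xs ! \<sigma> i)"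
      if "\<sigma> permutes {..<p + q}" "i < p + q" for \<sigma> i
      using permutes_in_image[OF that(1), of i] that(2) True wedge by (simp del: map_append)
    then show ?thesis
      using wedge True by (simp add: wedge_def del: map_append flip: map_append)
  qed (use wedge in \<open>simp add: wedge_def\<close>)
  moreover have "wedge (map ?f \<theta>s @ map ?f \<eta>s) \<in> forms_pq J' p q"
    using wedge by (intro forms_pq.wedge)
      (auto simp: covectors10_def covectors01_def \<pi> intro!: linear_compose[OF \<pi>(1)])
  ultimately show ?case
    by simp
qed (auto intro: forms_pq.intros)

lemma splits_by_type_pullback:
  assumes \<pi>: "linear \<pi>" "\<And>x. \<pi> (J' x) = J (\<pi> x)" and "splits_by_type J k \<alpha>"
  shows "splits_by_type J' k (\<lambda>xs. \<alpha> (map \<pi> xs))"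
proof -
  obtain \<gamma> where \<gamma>: "\<And>r. r \<le> k \<Longrightarrow> \<gamma> r \<in> forms_pq J r (k - r)" "\<alpha> = (\<lambda>xs. \<Sum>r\<le>k. \<gamma> r xs)"
    using assms(3) by (auto simp: splits_by_type_def)
  have "(\<lambda>xs. \<gamma> r (map \<pi> xs)) \<in> forms_pq J' r (k - r)" if "r \<le> k" for r
    by (rule forms_pq_pullback[where J = J, OF \<pi> \<gamma>(1)[OF that]])
  then show ?thesis
    unfolding splits_by_type_def \<gamma>(2) by (intro exI[of _ "\<lambda>r xs. \<gamma> r (map \<pi> xs)"]) simp
qed

text \<open>Pulling back a decomposition term by term gives a decomposition of the pullback, and by
  uniqueness it is the one that \<open>type_part\<close> selects.\<close>

lemma type_part_pullback:
  assumes \<pi>: "linear \<pi>" "\<And>x. \<pi> (J' x) = J (\<pi> x)" and "splits_by_type J (p + q) \<alpha>"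
  shows "type_part J' p q (\<lambda>xs. \<alpha> (map \<pi> xs)) = (\<lambda>xs. type_part J p q \<alpha> (map \<pi> xs))"
proof -
  obtain \<gamma> where \<gamma>: "\<And>r. r \<le> p + q \<Longrightarrow> \<gamma> r \<in> forms_pq J r (p + q - r)"
      "\<alpha> = (\<lambda>xs. \<Sum>r\<le>p + q. \<gamma> r xs)"
    using assms(3) by (auto simp: splits_by_type_def)
  have "type_part J' p q (\<lambda>xs. \<alpha> (map \<pi> xs)) = (\<lambda>r xs. \<gamma> r (map \<pi> xs)) p"
    by (rule type_part_eq) (use \<gamma> forms_pq_pullback[where \<pi> = \<pi> and J = J and J' = J', OF \<pi>] in auto)
  then show ?thesis
    by (simp add: type_part_eq[OF \<gamma>])
qed

lemma forms_pq_alternating: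
  assumes "\<alpha> \<in> forms_pq J p q"
  shows "alternating_form (p + q) \<alpha>"
  using assms
proof induction
  case (wedge \<theta>s \<eta>s)
  then show ?case
    using alternating_form_wedge[of "\<theta>s @ \<eta>s"] by (auto simp: covectors10_def covectors01_def)
qed (auto intro: alternating_form_zero alternating_form_add alternating_form_scale)

section \<open>The Chevalley-Eilenberg differential in low degrees\<close>

lemma ce_d_zero: "ce_d br (\<lambda>_. 0) = (\<lambda>_. 0)"
  by (simp add: ce_d_def fun_eq_iff)

text \<open>\<open>\<pi>\<close> carries brackets to brackets, and mapping it over a list commutes
  with omitting entries.\<close>

lemma ce_d_pullback:
  assumes "\<And>x y. \<pi> (br' x y) = br (\<pi> x) (\<pi> y)"
  shows "ce_d br' (\<lambda>xs. \<alpha> (map \<pi> xs)) = (\<lambda>xs. ce_d br \<alpha> (map \<pi> xs))"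
  by (auto simp: ce_d_def fun_eq_iff assms nths_map intro!: sum.cong)

text \<open>Each term puts one bracket in place of two arguments, so \<open>\<alpha>\<close> is
  evaluated on lists one entry shorter than \<open>xs\<close>.\<close>

lemma ce_d_length:
  assumes "\<And>xs. length xs \<noteq> k \<Longrightarrow> \<alpha> xs = 0" and "length xs \<noteq> Suc k"
  shows "ce_d br \<alpha> xs = 0"
proof -
  have "\<alpha> (br (xs ! i) (xs ! j) # nths xs (- {i, j})) = 0" if "i < j" "j < length xs" for i j
  proof (rule assms(1))
    have "{m. m < length xs \<and> m \<in> - {i, j}} = {..<length xs} - {i, j}"
      by auto
    then have "length (nths xs (- {i, j})) = length xs - 2"
      using that by (simp add: length_nths card_Diff_subset)
    then show "length (br (xs ! i) (xs ! j) # nths xs (- {i, j})) \<noteq> k"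
      using that assms(2) by simp
  qed
  then show ?thesis
    unfolding ce_d_def by (intro sum.neutral) auto
qed

lemma ce_d_3:
  "ce_d br \<alpha> [x, y, z] = - \<alpha> [br x y, z] + \<alpha> [br x z, y] - \<alpha> [br y z, x]"
proof -
  have "{(i, j). i < j \<and> j < length [x, y, z]} = {(0, 1), (0, 2), (1, 2)}"
    by (auto simp: less_Suc_eq numeral_eq_Suc)
  then show ?thesis
    by (simp add: ce_d_def nths_Cons numeral_eq_Suc)
qed

lemma ce_d_4:
  "ce_d br \<alpha> [x, y, z, w] = - \<alpha> [br x y, z, w] + \<alpha> [br x z, y, w] - \<alpha> [br x w, y, z]
     - \<alpha> [br y z, x, w] + \<alpha> [br y w, x, z] - \<alpha> [br z w, x, y]"
proof -
  have "{(i, j). i < j \<and> j < length [x, y, z, w]} = {(0, 1), (0, 2), (0, 3), (1, 2), (1, 3), (2, 3)}"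
    by (auto simp: less_Suc_eq numeral_eq_Suc)
  then show ?thesis
    by (simp add: ce_d_def nths_Cons numeral_eq_Suc)
qed

lemma bilinear_alternating_neg:
  assumes "bilinear br" "\<And>x. br x x = 0"
  shows "br x y = - br y x"
proof -
  have "br x y + br y x = br (x + y) (x + y)"
    by (simp only: bilinear_ladd[OF assms(1)] bilinear_radd[OF assms(1)]) (simp add: assms(2))
  then show ?thesis
    by (simp add: assms(2) eq_neg_iff_add_eq_0)
qed

text \<open>Needed so that the differential of the fundamental form splits by type. Linearity is
  read off the explicit formula; on repeated arguments the terms cancel by antisymmetry of the
  bracket.\<close>

lemma ce_d_alternating_2:
  fixes br :: "'a::real_vector \<Rightarrow> 'a \<Rightarrow> 'a"
  assumes br: "bilinear br" "\<And>x. br x x = 0" and \<alpha>: "alternating_form 2 \<alpha>"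
  shows "alternating_form 3 (ce_d br \<alpha>)"
proof -
  note m = alternating_form_multilinear[OF \<alpha>]
  have l0: "linear (\<lambda>x. \<alpha> [x, b])" for b
    using multilinear_form_linear[OF m, of "[0, b]" 0] by simp
  have l1: "linear (\<lambda>x. \<alpha> [a, x])" for a
    using multilinear_form_linear[OF m, of "[a, 0]" 1] by simp
  note L = linear_add[OF l0] linear_add[OF l1] linear_scale[OF l0] linear_scale[OF l1]
    linear_neg[OF l0] linear_neg[OF l1] linear_0[OF l0] linear_0[OF l1]
    bilinear_ladd[OF br(1)] bilinear_radd[OF br(1)] bilinear_lmul[OF br(1)] bilinear_rmul[OF br(1)]
  have "linear (\<lambda>x. ce_d br \<alpha> (xs[i := x]))" if xs: "length xs = 3" "i < 3" for xs i
  proof -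
    obtain a b c where "xs = [a, b, c]"
      using xs(1) by (auto simp: length_Suc_conv numeral_eq_Suc)
    moreover have "i = 0 \<or> i = 1 \<or> i = 2"
      using xs(2) by auto
    ultimately show ?thesis
      by (auto intro!: linearI simp: ce_d_3 L algebra_simps numeral_2_eq_2)
  qed
  moreover have "ce_d br \<alpha> xs = 0" if xs: "\<not> distinct xs" for xs
  proof (cases "length xs = 3")
    case True
    then obtain a b c where "xs = [a, b, c]"
      by (auto simp: length_Suc_conv numeral_eq_Suc)
    then show ?thesis
      using xs by (auto simp: ce_d_3 L br(2) bilinear_alternating_neg[OF br, of b a]
          bilinear_alternating_neg[OF br, of c a] bilinear_alternating_neg[OF br, of c b])
  next
    case False
    then show ?thesis
      by (intro ce_d_length[of 2]) (auto intro: multilinear_form_length[OF m])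
  qed
  moreover have "ce_d br \<alpha> xs = 0" if "length xs \<noteq> 3" for xs
    using that by (intro ce_d_length[of 2]) (auto intro: multilinear_form_length[OF m])
  ultimately show ?thesis
    by (simp add: alternating_form_def multilinear_form_def)
qed

text \<open>The same argument one degree higher, for the differential of the (1,2) part.\<close>

lemma ce_d_alternating_3:
  fixes br :: "'a::real_vector \<Rightarrow> 'a \<Rightarrow> 'a"
  assumes br: "bilinear br" "\<And>x. br x x = 0" and \<alpha>: "alternating_form 3 \<alpha>"
  shows "alternating_form 4 (ce_d br \<alpha>)"
proof -
  note m = alternating_form_multilinear[OF \<alpha>]
  have l0: "linear (\<lambda>x. \<alpha> [x, b, c])" for b c
    using multilinear_form_linear[OF m, of "[0, b, c]" 0] by simp
  have l1: "linear (\<lambda>x. \<alpha> [a, x, c])" for a c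
    using multilinear_form_linear[OF m, of "[a, 0, c]" 1] by simp
  have l2: "linear (\<lambda>x. \<alpha> [a, b, x])" for a b
    using multilinear_form_linear[OF m, of "[a, b, 0]" 2] by (simp add: numeral_2_eq_2)
  note L = linear_add[OF l0] linear_add[OF l1] linear_add[OF l2]
    linear_scale[OF l0] linear_scale[OF l1] linear_scale[OF l2]
    linear_neg[OF l0] linear_neg[OF l1] linear_neg[OF l2]
    linear_0[OF l0] linear_0[OF l1] linear_0[OF l2]
    bilinear_ladd[OF br(1)] bilinear_radd[OF br(1)] bilinear_lmul[OF br(1)] bilinear_rmul[OF br(1)]
  have rep: "\<alpha> [x, y, y] = 0" for x y
    by (rule alternating_form_not_distinct[OF \<alpha>]) simp
  \<comment> \<open>Polarization of \<open>rep\<close> in the last two arguments.\<close>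
  have swap: "\<alpha> [x, y, z] = - \<alpha> [x, z, y]" for x y z
    using rep[of x "y + z"] rep[of x y] rep[of x z] by (simp add: L eq_neg_iff_add_eq_0 add.commute)
  have "linear (\<lambda>x. ce_d br \<alpha> (xs[i := x]))" if xs: "length xs = 4" "i < 4" for xs i
  proof -
    obtain a b c d where "xs = [a, b, c, d]"
      using xs(1) by (auto simp: length_Suc_conv numeral_eq_Suc)
    moreover have "i = 0 \<or> i = 1 \<or> i = 2 \<or> i = 3"
      using xs(2) by auto
    ultimately show ?thesis
      by (auto intro!: linearI simp: ce_d_4 L algebra_simps numeral_2_eq_2 numeral_3_eq_3)
  qed
  moreover have "ce_d br \<alpha> xs = 0" if xs: "\<not> distinct xs" for xs
  proof (cases "length xs = 4")
    case True
    then obtain a b c d where "xs = [a, b, c, d]"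
      by (auto simp: length_Suc_conv numeral_eq_Suc)
    \<comment> \<open>The six positions of an equal pair. For the non-adjacent ones, brackets are
      reversed and the last two arguments exchanged before the terms cancel.\<close>
    moreover have "ce_d br \<alpha> [u, u, v, w] = 0" for u v w
      by (simp add: ce_d_4 L br(2) rep)
    moreover have "ce_d br \<alpha> [u, v, u, w] = 0" for u v w
      by (simp add: ce_d_4 L br(2) rep bilinear_alternating_neg[OF br, of v u] swap[of "br u w" v u])
    moreover have "ce_d br \<alpha> [u, v, w, u] = 0" for u v w
      by (simp add: ce_d_4 L br(2) rep bilinear_alternating_neg[OF br, of v u]
          bilinear_alternating_neg[OF br, of w u] swap[of "br u v" w u] swap[of "br u w" v u])
    moreover have "ce_d br \<alpha> [u, v, v, w] = 0" for u v w
      by (simp add: ce_d_4 L br(2) rep)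
    moreover have "ce_d br \<alpha> [u, v, w, v] = 0" for u v w
      by (simp add: ce_d_4 L br(2) rep bilinear_alternating_neg[OF br, of w v] swap[of "br u v" w v])
    moreover have "ce_d br \<alpha> [u, v, w, w] = 0" for u v w
      by (simp add: ce_d_4 L br(2) rep)
    ultimately show ?thesis
      using xs by auto
  next
    case False
    then show ?thesis
      by (intro ce_d_length[of 3]) (auto intro: multilinear_form_length[OF m])
  qed
  moreover have "ce_d br \<alpha> xs = 0" if "length xs \<noteq> 4" for xs
    using that by (intro ce_d_length[of 3]) (auto intro: multilinear_form_length[OF m])
  ultimately show ?thesis
    by (simp add: alternating_form_def multilinear_form_def)
qed

section \<open>The SKT condition for a fundamental form of type (1,1)\<close>

text \<open>Only the summand \<open>r = p\<close> survives, because all other components of a form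
  of pure type vanish.\<close>

lemma del_forms_pq:
  assumes "\<alpha> \<in> forms_pq J p q"
  shows "del br J (p + q) \<alpha> = type_part J (p + 1) q (ce_d br \<alpha>)"
proof
  fix xs
  have "del br J (p + q) \<alpha> xs =
      (\<Sum>r\<le>p + q. if r = p then type_part J (p + 1) q (ce_d br \<alpha>) xs else 0)"
    unfolding del_def
    by (intro sum.cong) (auto simp: type_part_forms_pq[OF assms] ce_d_zero type_part_zero)
  then show "del br J (p + q) \<alpha> xs = type_part J (p + 1) q (ce_d br \<alpha>) xs"
    by simp
qed

lemma delbar_forms_pq:
  assumes "\<alpha> \<in> forms_pq J p q"
  shows "delbar br J (p + q) \<alpha> = type_part J p (q + 1) (ce_d br \<alpha>)"
proof
  fix xs
  have "delbar br J (p + q) \<alpha> xs =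
      (\<Sum>r\<le>p + q. if r = p then type_part J p (q + 1) (ce_d br \<alpha>) xs else 0)"
    unfolding delbar_def
    by (intro sum.cong) (auto simp: type_part_forms_pq[OF assms] ce_d_zero type_part_zero)
  then show "delbar br J (p + q) \<alpha> xs = type_part J p (q + 1) (ce_d br \<alpha>) xs"
    by simp
qed

text \<open>For a form of type (1,1), applying \<open>delbar\<close> takes the (1,2) part of the
  differential. The splitting hypothesis ensures that this part is truly of type (1,2), so that
  \<open>del\<close> in turn takes a (2,2) part.\<close>

lemma SKT_iff_type_part:
  assumes "fundamental_form J g \<in> forms_pq J 1 1"
    and "splits_by_type J 3 (ce_d br (fundamental_form J g))"
  shows "SKT br J g \<longleftrightarrow>
    type_part J 2 2 (ce_d br (type_part J 1 2 (ce_d br (fundamental_form J g)))) = (\<lambda>_. 0)"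
  using delbar_forms_pq[OF assms(1), of br] del_forms_pq[OF type_part_in_forms_pq[of J 1 2], of _ br] assms(2)
  by (simp add: SKT_def numeral_eq_Suc)

section \<open>The fundamental form of a Hermitian Lie algebra\<close>

context hermitian_lie_algebra
begin

lemma g_J_left: "g (J X) Y = - g X (J Y)"
  using g_J[of X "J Y"] by (simp add: J_J bilinear_rneg[OF bilinear_g])

lemma fundamental_form_alternating: "alternating_form 2 (fundamental_form J g)"
proof -
  have "linear (\<lambda>x. fundamental_form J g (xs[i := x]))" if xs: "length xs = 2" "i < 2" for xs i
  proof -
    obtain a b where "xs = [a, b]"
      using xs(1) by (auto simp: length_Suc_conv numeral_eq_Suc)
    moreover have "i = 0 \<or> i = 1"
      using xs(2) by auto
    ultimately show ?thesis
      by (auto intro!: linearI simp: fundamental_form_def linear_add[OF linear_J] linear_scale[OF linear_J]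
          bilinear_ladd[OF bilinear_g] bilinear_radd[OF bilinear_g] bilinear_lmul[OF bilinear_g]
          bilinear_rmul[OF bilinear_g] scaleR_conv_of_real)
  qed
  \<comment> \<open>\<open>J\<close> is skew for \<open>g\<close>, so this value equals its own
    negative.\<close>
  moreover have "g (J X) X = 0" for X
    using g_J_left[of X X] g_sym[of X "J X"] by simp
  ultimately show ?thesis
    by (auto simp: alternating_form_def multilinear_form_def fundamental_form_def split: list.splits)
qed

lemma fundamental_form_J: "fundamental_form J g (map J xs) = fundamental_form J g xs"
  by (auto simp: fundamental_form_def g_J split: list.splits)

text \<open>
  \<open>J\<close> acts on the types \<open>(2,0)\<close> and \<open>(0,2)\<close> as \<open>-1\<close> and trivially on type \<open>(1,1)\<close>.
\<close>

lemma fundamental_form_in_forms_pq: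
  fixes B :: "'a set"
  assumes "finite B" "span B = UNIV"
  shows "fundamental_form J g \<in> forms_pq J 1 1"
proof -
  let ?\<omega> = "fundamental_form J g"
  have "splits_by_type J 2 ?\<omega>"
    by (rule splits_by_type_alternating[OF linear_J J_J assms fundamental_form_alternating])
  then obtain \<gamma> where \<gamma>: "\<And>r. r \<le> 2 \<Longrightarrow> \<gamma> r \<in> forms_pq J r (2 - r)"
      and \<omega>: "?\<omega> = (\<lambda>xs. \<Sum>r\<le>2. \<gamma> r xs)"
    by (auto simp: splits_by_type_def)
  have \<omega>_sum: "?\<omega> xs = \<gamma> 0 xs + \<gamma> 1 xs + \<gamma> 2 xs" for xs
    by (subst \<omega>) (simp add: numeral_2_eq_2)
  have "?\<omega> xs = \<gamma> 1 xs" for xs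
  proof -
    \<comment> \<open>At angle \<open>pi / 2\<close> the rotation is \<open>J\<close>
      itself.\<close>
    have "\<gamma> r (map J xs) = \<i> ^ r * (- \<i>) ^ (2 - r) * \<gamma> r xs" if "r \<le> 2" for r
      using forms_pq_rotation[OF \<gamma>[OF that], of "pi / 2" xs] by (simp flip: cis_cnj)
    then have "?\<omega> (map J xs) = - \<gamma> 0 xs + \<gamma> 1 xs - \<gamma> 2 xs"
      by (simp add: \<omega>_sum)
    then have "2 * ?\<omega> xs = 2 * \<gamma> 1 xs"
      using \<omega>_sum[of xs] unfolding fundamental_form_J by (simp add: algebra_simps)
    then show ?thesis
      by simp
  qed
  then have "?\<omega> = \<gamma> 1"
    by auto
  then show ?thesis
    using \<gamma>[of 1] by simp
qed

end

section \<open>Comparison of the tangent Lie algebra with its base\<close>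

theorem proposition3p1:
  fixes br D :: "'a::real_vector \<Rightarrow> 'a \<Rightarrow> 'a"
    and J :: "'a \<Rightarrow> 'a" and g :: "'a \<Rightarrow> 'a \<Rightarrow> real"
    and n :: nat and B :: "'a set"
  assumes "finite B" and "span B = UNIV" and "dim (UNIV :: 'a set) = 2 * n"
    and "hermitian_lie_algebra br J g"
    and "flat_connection br D"
    and "\<forall>X Y Z. g (D X Y) Z = - g Y (D X Z)"
    and "\<forall>X Y. D X (J Y) = J (D X Y)"
  shows "SKT (tangent_br br D) (tangent_J J) (tangent_g g) \<longleftrightarrow> SKT br J g"
proof -
  interpret hermitian_lie_algebra br J g by fact
  let ?br = "tangent_br br D" and ?J = "tangent_J J" and ?g = "tangent_g g"
  let ?\<omega> = "fundamental_form J g" and ?\<Omega> = "fundamental_form (tangent_J J) (tangent_g g)"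
  have fst_J: "fst (?J X) = J (fst X)" and snd_J: "snd (?J X) = J (snd X)" for X
    by (simp_all add: tangent_J_def split_beta)
  have fst_br: "fst (?br X Y) = br (fst X) (fst Y)" for X Y
    by (simp add: tangent_br_def split_beta)
  \<comment> \<open>Splitting by type is established on the base, where \<open>B\<close> is a finite
    spanning set; the tangent algebra inherits it by pullback.\<close>
  note splits = splits_by_type_alternating[OF linear_J J_J \<open>finite B\<close> \<open>span B = UNIV\<close>]
  note pullback = type_part_pullback[where \<pi> = fst and J = J and J' = ?J, OF linear_fst fst_J]
  have \<omega>: "?\<omega> \<in> forms_pq J 1 1"
    by (rule fundamental_form_in_forms_pq) fact+
  have d\<omega>: "splits_by_type J 3 (ce_d br ?\<omega>)"
    by (intro splits ce_d_alternating_2 bilinear_br br_self fundamental_form_alternating)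
  \<comment> \<open>This is \<open>delbar\<close> of the fundamental form of the base.\<close>
  define \<beta> where "\<beta> = type_part J 1 2 (ce_d br ?\<omega>)"
  have "\<beta> \<in> forms_pq J 1 2"
    using d\<omega> unfolding \<beta>_def by (intro type_part_in_forms_pq) (simp add: numeral_eq_Suc)
  then have d\<beta>: "splits_by_type J 4 (ce_d br \<beta>)"
    using forms_pq_alternating[of \<beta> J 1 2]
    by (intro splits ce_d_alternating_3 bilinear_br br_self) (simp add: numeral_eq_Suc)

  have \<Omega>_split: "?\<Omega> = (\<lambda>xs. ?\<omega> (map fst xs) + ?\<omega> (map snd xs))"
    by (auto simp: fun_eq_iff fundamental_form_def tangent_g_def tangent_J_def split_beta split: list.splits)
  have \<Omega>: "?\<Omega> \<in> forms_pq ?J 1 1"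
    unfolding \<Omega>_split
    by (intro forms_pq.add forms_pq_pullback[where \<pi> = fst and J = J and J' = ?J, OF linear_fst fst_J \<omega>] forms_pq_pullback[where \<pi> = snd and J = J and J' = ?J, OF linear_snd snd_J \<omega>])
  have d\<Omega>: "ce_d ?br ?\<Omega> = (\<lambda>xs. ce_d br ?\<omega> (map fst xs))"
  proof
    fix xs :: "('a \<times> 'a) list"
    show "ce_d ?br ?\<Omega> xs = ce_d br ?\<omega> (map fst xs)"
    proof (cases "length xs = 3")
      case True
      then obtain X Y Z where xs: "xs = [X, Y, Z]"
        by (auto simp: length_Suc_conv numeral_eq_Suc)
      \<comment> \<open>\<open>D u\<close> is skew for \<open>g\<close> and commutes with
        \<open>J\<close>, so composing it with \<open>J\<close> gives a symmetric operator. The six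
        terms from the second components then cancel in three pairs, one for each vector that
        \<open>D\<close> differentiates along.\<close>
      have "g (J (D u v)) w = g (J (D u w)) v" for u v w
        using assms(6,7) g_J_left g_sym by metis
      then show ?thesis
        by (simp add: xs ce_d_3 \<Omega>_split fst_br)
          (simp add: fundamental_form_def tangent_br_def split_beta linear_diff[OF linear_J]
            bilinear_lsub[OF bilinear_g])
    next
      case False
      have "ce_d ?br ?\<Omega> xs = 0" "ce_d br ?\<omega> (map fst xs) = 0"
        using False by (auto intro!: ce_d_length[of 2] simp: fundamental_form_def split: list.splits)
      then show ?thesis
        by simp
    qed
  qed
  have \<beta>': "type_part ?J 1 2 (ce_d ?br ?\<Omega>) = (\<lambda>xs. \<beta> (map fst xs))"
    unfolding d\<Omega> \<beta>_def by (rule pullback) (use d\<omega> in \<open>simp add: numeral_eq_Suc\<close>)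
  have "splits_by_type ?J 3 (ce_d ?br ?\<Omega>)"
    unfolding d\<Omega> by (rule splits_by_type_pullback[where \<pi> = fst and J = J and J' = ?J, OF linear_fst fst_J d\<omega>])
  then have "SKT ?br ?J ?g \<longleftrightarrow> type_part ?J 2 2 (ce_d ?br (\<lambda>xs. \<beta> (map fst xs))) = (\<lambda>_. 0)"
    unfolding \<beta>'[symmetric] by (rule SKT_iff_type_part[OF \<Omega>])
  also have "type_part ?J 2 2 (ce_d ?br (\<lambda>xs. \<beta> (map fst xs))) =
      (\<lambda>xs. type_part J 2 2 (ce_d br \<beta>) (map fst xs))"
    unfolding ce_d_pullback[where \<pi> = fst and br = br and \<alpha> = \<beta>, OF fst_br]
    by (rule pullback) (simp add: d\<beta>)
  also have "\<dots> = (\<lambda>_. 0) \<longleftrightarrow> type_part J 2 2 (ce_d br \<beta>) = (\<lambda>_. 0)"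
  proof
    assume *: "(\<lambda>xs :: ('a \<times> 'a) list. type_part J 2 2 (ce_d br \<beta>) (map fst xs)) = (\<lambda>_. 0)"
    show "type_part J 2 2 (ce_d br \<beta>) = (\<lambda>_. 0)"
    proof
      fix ys :: "'a list"
      \<comment> \<open>The diagonal is a section of \<open>fst\<close>, so every list of base
        vectors is the projection of a list in the tangent algebra.\<close>
      have "map fst (map (\<lambda>y. (y, y)) ys) = ys"
        by (simp add: o_def)
      then show "type_part J 2 2 (ce_d br \<beta>) ys = 0"
        using fun_cong[OF *, of "map (\<lambda>y. (y, y)) ys"] by simp
    qed
  qed simp
  also have "\<dots> \<longleftrightarrow> SKT br J g"
    unfolding \<beta>_def by (rule SKT_iff_type_part[OF \<omega> d\<omega>, symmetric])
  finally show ?thesis .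
qed

end
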